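(* Let $\bar{\mathbf w}=(\bar x_t,\bar u_t,\bar\phi_t)_{t=1}^N$ be a current iterate with $\bar x_1=\hat x_1$ and $\bar x_{t+1}=f(\bar x_t,\bar u_t)$ for $t\in[N-1]$, let $\alpha_t,\beta_t,\psi_t,\omega_t$ be the backward-pass parameters computed at $\bar{\mathbf w}$, and let $\mathbf w^+(\gamma)$ be the forward-pass trial point with step size $\gamma$ (see context). Let $\mathcal L(\mathbf w)=\sum_{t=1}^N L(x_t,u_t,\phi_t)$ and $$m:=\sum_{t=1}^N\left(\bar Q_u^t\alpha_t+\psi_t^\top\bar c^t\right).$$ Then $$m=\frac{d}{d\gamma}\mathcal L(\mathbf w^+(\gamma))\Big|_{\gamma=0}.$$
   Context: Notation: $[N]=\{1,\dots,N\}$. Gradients of scalar functions are row vectors; for vector-valued $g$ with values in $\mathbb R^c$, $\nabla_x g\in\mathbb R^{c\times n}$ and second derivatives are tensors whose first dimension indexes the components of $g$; for a vector $v$ (row or column), $v\cdot g_{yz}=\sum_i v^{(i)}\nabla^2_{yz}g_i$ (contraction along the first dimension). Problem: the discrete-time optimal control problem of minimising $\sum_{t=1}^N\ell(x_t,u_t)$ subject to $x_1=\hat x_1$, $x_{t+1}=f(x_t,u_t)$ for $t\in[N-1]$, and $c(x_t,u_t)=0$ for $t\in[N]$, where $x_t\in\mathbb R^{n_x}$, $u_t\in\mathbb R^{n_u}$, $\ell:\mathbb R^{n_x}\times\mathbb R^{n_u}\to\mathbb R$, $f:\mathbb R^{n_x}\times\mathbb R^{n_u}\to\mathbb R^{n_x}$,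 $c:\mathbb R^{n_x}\times\mathbb R^{n_u}\to\mathbb R^{n_c}$, $n_c\le n_u$, all twice continuously differentiable. Let $L(x,u,\phi):=\ell(x,u)+\phi^\top c(x,u)$ with $\phi\in\mathbb R^{n_c}$. A bar denotes evaluation at the current iterate: $\bar h^t=h(\bar x_t,\bar u_t,\bar\phi_t)$, $\bar h^t_y=\nabla_y h(\bar x_t,\bar u_t,\bar\phi_t)$, and similarly for second derivatives. Backward pass of FilterDDP: set $\bar\lambda_{N+1}=0\in\mathbb R^{n_x}$, $\bar V_x^{N+1}=0\in\mathbb R^{1\times n_x}$, $P_{N+1}=0\in\mathbb R^{n_x\times n_x}$. For $t=N,\dots,1$ put $A_t=(\bar c_u^t)^\top$, $\bar Q_x^t=\bar L_x^t+\bar V_x^{t+1}\bar f_x^t$, $\bar Q_u^t=\bar L_u^t+\bar V_x^{t+1}\bar f_u^t$, $H_t=\bar L_{uu}^t+(\bar f_u^t)^\top P_{t+1}\bar f_u^t+\bar\lambda_{t+1}\cdot\bar f_{uu}^t$, $B_t=\bar L_{ux}^t+(\bar f_u^t)^\top P_{t+1}\bar f_x^t+\bar\lambda_{t+1}\cdot\bar f_{ux}^t$, $C_t=\bar L_{xx}^t+(\bar f_x^t)^\top P_{t+1}\bar f_x^t+\bar\lambda_{t+1}\cdot\bar f_{xx}^t$. Choose $\delta_w,\delta_c\ge0$ (depending on $t$) such that $$K_t=\begin{bmatrix}H_t+\delta_wI&A_t\\ A_t^\top&-\delta_cI\end{bmatrix}$$ has inertia $(n_u,n_c,0)$ (numbers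 of positive, negative, zero eigenvalues), and let $\alpha_t\in\mathbb R^{n_u},\beta_t\in\mathbb R^{n_u\times n_x},\psi_t\in\mathbb R^{n_c},\omega_t\in\mathbb R^{n_c\times n_x}$ solve $$K_t\begin{bmatrix}\alpha_t&\beta_t\\\psi_t&\omega_t\end{bmatrix}=-\begin{bmatrix}(\bar Q_u^t)^\top&B_t\\\bar c^t&\bar c_x^t\end{bmatrix}.$$ Then set $\bar V_x^t=\bar Q_x^t+\bar Q_u^t\beta_t+(\bar c^t)^\top\omega_t$, $\bar\lambda_t^\top=\bar L_x^t+\bar\lambda_{t+1}^\top\bar f_x^t$, $P_t=C_t+\beta_t^\top H_t\beta_t+B_t^\top\beta_t+\beta_t^\top B_t$. Forward pass with step size $\gamma$: $x_1^+=\hat x_1$, $u_t^+(x,\gamma)=\bar u_t+\gamma\alpha_t+\beta_t(x-\bar x_t)$, $\phi_t^+(x,\gamma)=\bar\phi_t+\gamma\psi_t+\omega_t(x-\bar x_t)$, $x_{t+1}^+=f(x_t^+,u_t^+(x_t^+,\gamma))$, and $\mathbf w^+(\gamma)=(x_t^+,u_t^+(x_t^+,\gamma),\phi_t^+(x_t^+,\gamma))_{t=1}^N$. The formulas are regarded as defined for all real $\gamma$ near $0$. *)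

theory Defs
  imports "HOL-Analysis.Analysis" "HOL-Computational_Algebra.Polynomial"
begin

section \<open>Derivatives\<close>

definition twice_continuously_differentiable ::
    "('a::real_normed_vector \<Rightarrow> 'b::real_normed_vector) \<Rightarrow> bool" where
  "twice_continuously_differentiable g \<longleftrightarrow>
     (\<exists>(g' :: 'a \<Rightarrow> 'a \<Rightarrow>\<^sub>L 'b) (g'' :: 'a \<Rightarrow> 'a \<Rightarrow>\<^sub>L ('a \<Rightarrow>\<^sub>L 'b)).
        (\<forall>z. (g has_derivative blinfun_apply (g' z)) (at z)) \<and>
        (\<forall>z. (g' has_derivative blinfun_apply (g'' z)) (at z)) \<and>
        continuous_on UNIV g'')"

text \<open>Row vectors are identified with elements of \<open>real ^ 'n\<close>: a row vector \<open>v\<close> times a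
  matrix \<open>M\<close> is \<open>v v* M\<close>, and a row vector times a column vector is the inner product.\<close>

definition grad :: "(real^'n \<Rightarrow> real) \<Rightarrow> real^'n \<Rightarrow> real^'n" where
  "grad g y = (\<chi> i. frechet_derivative g (at y) (axis i 1))"

definition hess :: "(real^'n \<Rightarrow> real) \<Rightarrow> real^'n \<Rightarrow> real^'n^'n" where
  "hess g y = jacobian (grad g) (at y)"

text \<open>The matrix of second derivatives with rows indexed by the components of the first
  argument \<open>y\<close> and columns indexed by the components of the second argument \<open>z\<close>.\<close>

definition mixed_hess :: "(real^'p \<Rightarrow> real^'q \<Rightarrow> real) \<Rightarrow> real^'p \<Rightarrow> real^'q \<Rightarrow> real^'q^'p" where
  "mixed_hess h y z = jacobian (\<lambda>z'. grad (\<lambda>y'. h y' z') y) (at z)"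

text \<open>\<open>v \<cdot> g\<^sub>y\<^sub>y\<close> and \<open>v \<cdot> g\<^sub>y\<^sub>z\<close>, contracting over the components of \<open>g\<close>.\<close>

definition contract_hess :: "real^'k \<Rightarrow> (real^'n \<Rightarrow> real^'k) \<Rightarrow> real^'n \<Rightarrow> real^'n^'n" where
  "contract_hess v g y = (\<Sum>i\<in>UNIV. (v $ i) *\<^sub>R hess (\<lambda>y'. g y' $ i) y)"

definition contract_mixed_hess ::
    "real^'k \<Rightarrow> (real^'p \<Rightarrow> real^'q \<Rightarrow> real^'k) \<Rightarrow> real^'p \<Rightarrow> real^'q \<Rightarrow> real^'q^'p" where
  "contract_mixed_hess v g y z = (\<Sum>i\<in>UNIV. (v $ i) *\<^sub>R mixed_hess (\<lambda>y' z'. g y' z' $ i) y z)"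


section \<open>Block matrices and inertia\<close>

definition block_mat ::
    "'a^'p^'m \<Rightarrow> 'a^'q^'m \<Rightarrow> 'a^'p^'c \<Rightarrow> 'a^'q^'c \<Rightarrow> 'a^('p + 'q)^('m + 'c)" where
  "block_mat M11 M12 M21 M22 = (\<chi> i j.
     case i of
       Inl i' \<Rightarrow> (case j of Inl j' \<Rightarrow> M11 $ i' $ j' | Inr j' \<Rightarrow> M12 $ i' $ j')
     | Inr i' \<Rightarrow> (case j of Inl j' \<Rightarrow> M21 $ i' $ j' | Inr j' \<Rightarrow> M22 $ i' $ j'))"

definition charpoly :: "real^'n^'n \<Rightarrow> real poly" where
  "charpoly M = det (mat [:0, 1:] - map_matrix (\<lambda>a. [:a:]) M)"

text \<open>The numbers of positive, negative and zero eigenvalues, counted with multiplicity; only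
  real eigenvalues are counted, so this is meant for symmetric matrices.\<close>

definition inertia :: "real^'n^'n \<Rightarrow> nat \<times> nat \<times> nat" where
  "inertia M =
     (\<Sum>r | poly (charpoly M) r = 0 \<and> r > 0. order r (charpoly M),
      \<Sum>r | poly (charpoly M) r = 0 \<and> r < 0. order r (charpoly M),
      order 0 (charpoly M))"


section \<open>The backward pass\<close>

definition Lag :: "((real^'n) \<times> (real^'m) \<Rightarrow> real) \<Rightarrow> ((real^'n) \<times> (real^'m) \<Rightarrow> real^'c) \<Rightarrow>
    real^'n \<Rightarrow> real^'m \<Rightarrow> real^'c \<Rightarrow> real" where
  "Lag ell c x u \<phi> = ell (x, u) + \<phi> \<bullet> c (x, u)"

abbreviation jac_x :: "((real^'n) \<times> (real^'m) \<Rightarrow> real^'k) \<Rightarrow> real^'n \<Rightarrow> real^'m \<Rightarrow> real^'n^'k" where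
  "jac_x g x u \<equiv> jacobian (\<lambda>x'. g (x', u)) (at x)"

abbreviation jac_u :: "((real^'n) \<times> (real^'m) \<Rightarrow> real^'k) \<Rightarrow> real^'n \<Rightarrow> real^'m \<Rightarrow> real^'m^'k" where
  "jac_u g x u \<equiv> jacobian (\<lambda>u'. g (x, u')) (at u)"

abbreviation Lag_x where
  "Lag_x ell c x u \<phi> \<equiv> grad (\<lambda>x'. Lag ell c x' u \<phi>) x"

abbreviation Lag_u where
  "Lag_u ell c x u \<phi> \<equiv> grad (\<lambda>u'. Lag ell c x u' \<phi>) u"

text \<open>In the following definitions \<open>(x, u, \<phi>)\<close> is the point of evaluation at stage \<open>t\<close>, while
  \<open>v\<close>, \<open>lam\<close> and \<open>P\<close> are the value gradient, the costate and the matrix of stage \<open>t + 1\<close>.\<close>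

definition Q_x where
  "Q_x ell f c x u \<phi> v = Lag_x ell c x u \<phi> + v v* jac_x f x u"

definition Q_u where
  "Q_u ell f c x u \<phi> v = Lag_u ell c x u \<phi> + v v* jac_u f x u"

definition H_mat where
  "H_mat ell f c x u \<phi> lam P =
     hess (\<lambda>u'. Lag ell c x u' \<phi>) u
     + transpose (jac_u f x u) ** P ** jac_u f x u
     + contract_hess lam (\<lambda>u'. f (x, u')) u"

definition B_mat where
  "B_mat ell f c x u \<phi> lam P =
     mixed_hess (\<lambda>u' x'. Lag ell c x' u' \<phi>) u x
     + transpose (jac_u f x u) ** P ** jac_x f x u
     + contract_mixed_hess lam (\<lambda>u' x'. f (x', u')) u x"

definition C_mat where
  "C_mat ell f c x u \<phi> lam P =
     hess (\<lambda>x'. Lag ell c x' u \<phi>) x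
     + transpose (jac_x f x u) ** P ** jac_x f x u
     + contract_hess lam (\<lambda>x'. f (x', u)) x"

definition KKT_mat :: "real^'m^'m \<Rightarrow> real^'c^'m \<Rightarrow> real \<Rightarrow> real \<Rightarrow> real^('m + 'c)^('m + 'c)" where
  "KKT_mat H A \<delta>w \<delta>c = block_mat (H + \<delta>w *\<^sub>R mat 1) A (transpose A) (- (\<delta>c *\<^sub>R mat 1))"

text \<open>The choice of regularisation parameters and the resulting gains at a single stage. The
  column index type \<open>1 + 'n\<close> of the right-hand side consists of one column for the
  feedforward terms and \<open>'n\<close> columns for the feedback terms.\<close>

definition stage_gains ::
    "((real^'n) \<times> (real^'m) \<Rightarrow> real) \<Rightarrow> ((real^'n) \<times> (real^'m) \<Rightarrow> real^'n) \<Rightarrow>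
     ((real^'n) \<times> (real^'m) \<Rightarrow> real^'c) \<Rightarrow> real^'n \<Rightarrow> real^'m \<Rightarrow> real^'c \<Rightarrow>
     real^'n \<Rightarrow> real^'n \<Rightarrow> real^'n^'n \<Rightarrow> real \<Rightarrow> real \<Rightarrow>
     real^'m \<Rightarrow> real^'n^'m \<Rightarrow> real^'c \<Rightarrow> real^'n^'c \<Rightarrow> bool" where
  "stage_gains ell f c x u \<phi> v lam P \<delta>w \<delta>c \<alpha> \<beta> \<psi> \<omega> \<longleftrightarrow>
     (let K = KKT_mat (H_mat ell f c x u \<phi> lam P) (transpose (jac_u c x u)) \<delta>w \<delta>c;
          rhs = block_mat (columnvector (Q_u ell f c x u \<phi> v)) (B_mat ell f c x u \<phi> lam P)
                          (columnvector (c (x, u))) (jac_x c x u) :: real^(1 + 'n)^('m + 'c)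
      in 0 \<le> \<delta>w \<and> 0 \<le> \<delta>c \<and>
         inertia K = (CARD('m), CARD('c), 0) \<and>
         K ** block_mat (columnvector \<alpha>) \<beta> (columnvector \<psi>) \<omega> = - rhs)"

definition backward_pass ::
    "nat \<Rightarrow> ((real^'n) \<times> (real^'m) \<Rightarrow> real) \<Rightarrow> ((real^'n) \<times> (real^'m) \<Rightarrow> real^'n) \<Rightarrow>
     ((real^'n) \<times> (real^'m) \<Rightarrow> real^'c) \<Rightarrow>
     (nat \<Rightarrow> real^'n) \<Rightarrow> (nat \<Rightarrow> real^'m) \<Rightarrow> (nat \<Rightarrow> real^'c) \<Rightarrow>
     (nat \<Rightarrow> real^'n) \<Rightarrow> (nat \<Rightarrow> real^'n) \<Rightarrow> (nat \<Rightarrow> real^'n^'n) \<Rightarrow>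
     (nat \<Rightarrow> real) \<Rightarrow> (nat \<Rightarrow> real) \<Rightarrow>
     (nat \<Rightarrow> real^'m) \<Rightarrow> (nat \<Rightarrow> real^'n^'m) \<Rightarrow> (nat \<Rightarrow> real^'c) \<Rightarrow> (nat \<Rightarrow> real^'n^'c) \<Rightarrow> bool" where
  "backward_pass N ell f c xb ub \<phi>b V lam P \<delta>w \<delta>c \<alpha> \<beta> \<psi> \<omega> \<longleftrightarrow>
     lam (N + 1) = 0 \<and> V (N + 1) = 0 \<and> P (N + 1) = 0 \<and>
     (\<forall>t\<in>{1..N}.
        let H = H_mat ell f c (xb t) (ub t) (\<phi>b t) (lam (t + 1)) (P (t + 1));
            B = B_mat ell f c (xb t) (ub t) (\<phi>b t) (lam (t + 1)) (P (t + 1));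
            C = C_mat ell f c (xb t) (ub t) (\<phi>b t) (lam (t + 1)) (P (t + 1))
        in stage_gains ell f c (xb t) (ub t) (\<phi>b t) (V (t + 1)) (lam (t + 1)) (P (t + 1))
             (\<delta>w t) (\<delta>c t) (\<alpha> t) (\<beta> t) (\<psi> t) (\<omega> t) \<and>
           V t = Q_x ell f c (xb t) (ub t) (\<phi>b t) (V (t + 1))
                 + Q_u ell f c (xb t) (ub t) (\<phi>b t) (V (t + 1)) v* \<beta> t
                 + c (xb t, ub t) v* \<omega> t \<and>
           lam t = Lag_x ell c (xb t) (ub t) (\<phi>b t) + lam (t + 1) v* jac_x f (xb t) (ub t) \<and>
           P t = C + transpose (\<beta> t) ** H ** \<beta> t + transpose B ** \<beta> t + transpose (\<beta> t) ** B)"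


section \<open>The forward pass\<close>

definition trial_u ::
    "(nat \<Rightarrow> real^'n) \<Rightarrow> (nat \<Rightarrow> real^'m) \<Rightarrow> (nat \<Rightarrow> real^'m) \<Rightarrow> (nat \<Rightarrow> real^'n^'m) \<Rightarrow>
     nat \<Rightarrow> real^'n \<Rightarrow> real \<Rightarrow> real^'m" where
  "trial_u xb ub \<alpha> \<beta> t x \<gamma> = ub t + \<gamma> *\<^sub>R \<alpha> t + \<beta> t *v (x - xb t)"

definition trial_phi ::
    "(nat \<Rightarrow> real^'n) \<Rightarrow> (nat \<Rightarrow> real^'c) \<Rightarrow> (nat \<Rightarrow> real^'c) \<Rightarrow> (nat \<Rightarrow> real^'n^'c) \<Rightarrow>
     nat \<Rightarrow> real^'n \<Rightarrow> real \<Rightarrow> real^'c" where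
  "trial_phi xb \<phi>b \<psi> \<omega> t x \<gamma> = \<phi>b t + \<gamma> *\<^sub>R \<psi> t + \<omega> t *v (x - xb t)"

text \<open>Stages are numbered from 1; the value at index 0 is a dummy.\<close>

primrec trial_x ::
    "((real^'n) \<times> (real^'m) \<Rightarrow> real^'n) \<Rightarrow> real^'n \<Rightarrow>
     (nat \<Rightarrow> real^'n) \<Rightarrow> (nat \<Rightarrow> real^'m) \<Rightarrow> (nat \<Rightarrow> real^'m) \<Rightarrow> (nat \<Rightarrow> real^'n^'m) \<Rightarrow>
     real \<Rightarrow> nat \<Rightarrow> real^'n" where
  "trial_x f xhat xb ub \<alpha> \<beta> \<gamma> 0 = xhat"
| "trial_x f xhat xb ub \<alpha> \<beta> \<gamma> (Suc t) =
     (if t = 0 then xhat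
      else f (trial_x f xhat xb ub \<alpha> \<beta> \<gamma> t,
              trial_u xb ub \<alpha> \<beta> t (trial_x f xhat xb ub \<alpha> \<beta> \<gamma> t) \<gamma>))"

definition trial_point ::
    "((real^'n) \<times> (real^'m) \<Rightarrow> real^'n) \<Rightarrow> real^'n \<Rightarrow>
     (nat \<Rightarrow> real^'n) \<Rightarrow> (nat \<Rightarrow> real^'m) \<Rightarrow> (nat \<Rightarrow> real^'c) \<Rightarrow>
     (nat \<Rightarrow> real^'m) \<Rightarrow> (nat \<Rightarrow> real^'n^'m) \<Rightarrow> (nat \<Rightarrow> real^'c) \<Rightarrow> (nat \<Rightarrow> real^'n^'c) \<Rightarrow>
     real \<Rightarrow> nat \<Rightarrow> (real^'n) \<times> (real^'m) \<times> (real^'c)" where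
  "trial_point f xhat xb ub \<phi>b \<alpha> \<beta> \<psi> \<omega> \<gamma> t =
     (let x = trial_x f xhat xb ub \<alpha> \<beta> \<gamma> t
      in (x, trial_u xb ub \<alpha> \<beta> t x \<gamma>, trial_phi xb \<phi>b \<psi> \<omega> t x \<gamma>))"

definition total_Lag ::
    "nat \<Rightarrow> ((real^'n) \<times> (real^'m) \<Rightarrow> real) \<Rightarrow> ((real^'n) \<times> (real^'m) \<Rightarrow> real^'c) \<Rightarrow>
     (nat \<Rightarrow> (real^'n) \<times> (real^'m) \<times> (real^'c)) \<Rightarrow> real" where
  "total_Lag N ell c w = (\<Sum>t=1..N. case w t of (x, u, \<phi>) \<Rightarrow> Lag ell c x u \<phi>)"

end

theory Submission
  imports Defs
begin

text \<open>Let \<open>d\<^sub>t\<close> be the derivative of the trial state \<open>x\<^sub>t\<^sup>+\<close> at \<open>\<gamma> = 0\<close>, so that \<open>d\<^sub>1 = 0\<close> and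
  \<open>d\<^sub>t\<^sub>+\<^sub>1 = f\<^sub>x d\<^sub>t + f\<^sub>u (\<alpha>\<^sub>t + \<beta>\<^sub>t d\<^sub>t)\<close>. Substituting the definitions of \<open>Q\<^sub>x\<close>, \<open>Q\<^sub>u\<close> and \<open>V\<^sub>t\<close> into
  the chain rule, the derivative of the stage Lagrangian at stage \<open>t\<close> is
  \<open>Q\<^sub>u \<alpha>\<^sub>t + \<psi>\<^sub>t \<bullet> c + V\<^sub>t d\<^sub>t - V\<^sub>t\<^sub>+\<^sub>1 d\<^sub>t\<^sub>+\<^sub>1\<close>. The sum over \<open>t\<close> telescopes, and both boundary terms
  vanish because \<open>d\<^sub>1 = 0\<close> and \<open>V\<^sub>N\<^sub>+\<^sub>1 = 0\<close>.\<close>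

lemma twice_continuously_differentiable_imp_differentiable:
  assumes "twice_continuously_differentiable g"
  shows "g differentiable (at z)"
  using assms unfolding twice_continuously_differentiable_def differentiable_def by blast

text \<open>Expand \<open>d\<close> in the standard basis and use linearity of the derivative. This
  bridges the coordinate definition of \<open>grad\<close> and the chain rule.\<close>

lemma grad_inner:
  assumes "g differentiable (at y)"
  shows "grad g y \<bullet> d = frechet_derivative g (at y) d"
proof -
  interpret bounded_linear "frechet_derivative g (at y)"
    using assms frechet_derivative_works has_derivative_bounded_linear by blast
  have "frechet_derivative g (at y) d
      = frechet_derivative g (at y) (\<Sum>i\<in>UNIV. d $ i *\<^sub>R axis i 1)"
    by (simp flip: scalar_mult_eq_scaleR add: basis_expansion)
  also have "\<dots> = (\<Sum>i\<in>UNIV. d $ i * frechet_derivative g (at y) (axis i 1))"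
    by (simp add: sum scaleR)
  finally show ?thesis
    by (simp add: grad_def inner_vec_def mult.commute)
qed

lemma has_derivative_fst_slice:
  assumes "(g has_derivative g') (at (x, u))"
  shows "((\<lambda>x'. g (x', u)) has_derivative (\<lambda>h. g' (h, 0))) (at x)"
  by (rule has_derivative_compose[where f = "\<lambda>x'. (x', u)", OF _ assms])
     (auto intro!: derivative_eq_intros)

lemma has_derivative_snd_slice:
  assumes "(g has_derivative g') (at (x, u))"
  shows "((\<lambda>u'. g (x, u')) has_derivative (\<lambda>h. g' (0, h))) (at u)"
  by (rule has_derivative_compose[where f = "\<lambda>u'. (x, u')", OF _ assms])
     (auto intro!: derivative_eq_intros)

lemma derivative_pair_split:
  assumes "(g has_derivative g') (at z)"
  shows "g' (a, b) = g' (a, 0) + g' (0, b)"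
  using linear_add[OF has_derivative_linear[OF assms], of "(a, 0)" "(0, b)"] by simp

text \<open>The total derivative splits by linearity into its restrictions to the two factors. Each
  restriction is the derivative of a slice, so uniqueness of derivatives identifies it with a
  partial Jacobian.\<close>

lemma has_derivative_partial_jacobians:
  fixes g :: "(real^'n) \<times> (real^'m) \<Rightarrow> real^'k"
  assumes "g differentiable (at (x, u))"
  shows "(g has_derivative (\<lambda>(a, b). jac_x g x u *v a + jac_u g x u *v b)) (at (x, u))"
proof -
  obtain g' where g': "(g has_derivative g') (at (x, u))"
    using assms unfolding differentiable_def by blast
  have x: "(\<lambda>h. jac_x g x u *v h) = (\<lambda>h. g' (h, 0))"
    by (metis has_derivative_fst_slice[OF g'] jacobian_works differentiableI has_derivative_unique)
  have u: "(\<lambda>h. jac_u g x u *v h) = (\<lambda>h. g' (0, h))"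
    by (metis has_derivative_snd_slice[OF g'] jacobian_works differentiableI has_derivative_unique)
  have "g' (a, b) = jac_x g x u *v a + jac_u g x u *v b" for a b
    using derivative_pair_split[OF g', of a b] fun_cong[OF x, of a] fun_cong[OF u, of b] by simp
  then have "g' = (\<lambda>(a, b). jac_x g x u *v a + jac_u g x u *v b)"
    by auto
  with g' show ?thesis by simp
qed

text \<open>Counterpart for values in \<open>real\<close> rather than \<open>real^'k\<close>:
  \<open>grad_inner\<close> takes over the role of \<open>jacobian_works\<close>.\<close>

lemma has_derivative_partial_grads:
  fixes g :: "(real^'n) \<times> (real^'m) \<Rightarrow> real"
  assumes "g differentiable (at (x, u))"
  shows "(g has_derivative (\<lambda>(a, b). grad (\<lambda>x'. g (x', u)) x \<bullet> a + grad (\<lambda>u'. g (x, u')) u \<bullet> b))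
           (at (x, u))"
proof -
  obtain g' where g': "(g has_derivative g') (at (x, u))"
    using assms unfolding differentiable_def by blast
  note slices = has_derivative_fst_slice[OF g'] has_derivative_snd_slice[OF g']
  have "g' (a, b) = grad (\<lambda>x'. g (x', u)) x \<bullet> a + grad (\<lambda>u'. g (x, u')) u \<bullet> b" for a b
    using derivative_pair_split[OF g', of a b] slices[THEN differentiableI, THEN grad_inner]
    by (simp flip: slices[THEN frechet_derivative_at])
  then have "g' = (\<lambda>(a, b). grad (\<lambda>x'. g (x', u)) x \<bullet> a + grad (\<lambda>u'. g (x, u')) u \<bullet> b)"
    by auto
  with g' show ?thesis by simp
qed

text \<open>Serves both the dynamics \<open>f\<close>, to propagate the state, and the constraint
  \<open>c\<close> inside the Lagrangian.\<close>

lemma has_vector_derivative_jacobian_chain: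
  fixes f :: "(real^'n) \<times> (real^'m) \<Rightarrow> real^'k"
  assumes "f differentiable (at (x s, u s))"
    and "(x has_vector_derivative dx) (at s)"
    and "(u has_vector_derivative du) (at s)"
  shows "((\<lambda>\<gamma>. f (x \<gamma>, u \<gamma>)) has_vector_derivative
            jac_x f (x s) (u s) *v dx + jac_u f (x s) (u s) *v du) (at s)"
  using vector_derivative_diff_chain_within[OF has_vector_derivative_Pair[OF assms(2,3)]
      has_derivative_at_withinI[OF has_derivative_partial_jacobians[OF assms(1)]]]
  by (simp add: o_def)

text \<open>Freeze the multiplier at \<open>\<phi> s\<close>: the Lagrangian is then a function of
  state and control alone, plus the correction
  \<open>(\<phi> \<gamma> - \<phi> s) \<bullet> c\<close>.\<close>

lemma has_real_derivative_Lag: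
  fixes ell :: "(real^'n) \<times> (real^'m) \<Rightarrow> real" and c :: "(real^'n) \<times> (real^'m) \<Rightarrow> real^'c"
  assumes ell: "ell differentiable (at (x s, u s))" and c: "c differentiable (at (x s, u s))"
    and x: "(x has_vector_derivative dx) (at s)"
    and u: "(u has_vector_derivative du) (at s)"
    and \<phi>: "(\<phi> has_vector_derivative d\<phi>) (at s)"
  shows "((\<lambda>\<gamma>. Lag ell c (x \<gamma>) (u \<gamma>) (\<phi> \<gamma>)) has_real_derivative
            Lag_x ell c (x s) (u s) (\<phi> s) \<bullet> dx + Lag_u ell c (x s) (u s) (\<phi> s) \<bullet> du
            + c (x s, u s) \<bullet> d\<phi>) (at s)"
proof -
  define g where "g z = ell z + \<phi> s \<bullet> c z" for z
  have "g differentiable (at (x s, u s))"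
    unfolding g_def using ell c by (auto intro!: derivative_intros differentiable_inner)
  from vector_derivative_diff_chain_within[OF has_vector_derivative_Pair[OF x u]
      has_derivative_at_withinI[OF has_derivative_partial_grads[OF this]]]
  have frozen: "((\<lambda>\<gamma>. g (x \<gamma>, u \<gamma>)) has_vector_derivative
      Lag_x ell c (x s) (u s) (\<phi> s) \<bullet> dx + Lag_u ell c (x s) (u s) (\<phi> s) \<bullet> du) (at s)"
    by (simp add: o_def g_def Lag_def)
  have cxu: "((\<lambda>\<gamma>. c (x \<gamma>, u \<gamma>)) has_vector_derivative
      jac_x c (x s) (u s) *v dx + jac_u c (x s) (u s) *v du) (at s)"
    by (rule has_vector_derivative_jacobian_chain[OF c x u])
  \<comment> \<open>The first factor vanishes at \<open>s\<close>, so the product rule leaves no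
    term with the derivative of \<open>c\<close>.\<close>
  have "((\<lambda>\<gamma>. (\<phi> \<gamma> - \<phi> s) \<bullet> c (x \<gamma>, u \<gamma>)) has_vector_derivative d\<phi> \<bullet> c (x s, u s)) (at s)"
    using bounded_bilinear.has_vector_derivative[OF bounded_bilinear_inner
        has_vector_derivative_diff[OF \<phi> has_vector_derivative_const[of "\<phi> s"]] cxu]
    by simp
  from has_vector_derivative_add[OF frozen this]
  show ?thesis
    by (simp add: g_def Lag_def has_real_derivative_iff_has_vector_derivative algebra_simps
        inner_commute)
qed

theorem corollary1:
  fixes N :: nat
    and ell :: "(real^'n) \<times> (real^'m) \<Rightarrow> real"
    and f :: "(real^'n) \<times> (real^'m) \<Rightarrow> real^'n"
    and c :: "(real^'n) \<times> (real^'m) \<Rightarrow> real^'c"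
    and xhat :: "real^'n"
    and xb :: "nat \<Rightarrow> real^'n" and ub :: "nat \<Rightarrow> real^'m" and \<phi>b :: "nat \<Rightarrow> real^'c"
    and V lam :: "nat \<Rightarrow> real^'n" and P :: "nat \<Rightarrow> real^'n^'n"
    and \<delta>w \<delta>c :: "nat \<Rightarrow> real"
    and \<alpha> :: "nat \<Rightarrow> real^'m" and \<beta> :: "nat \<Rightarrow> real^'n^'m"
    and \<psi> :: "nat \<Rightarrow> real^'c" and \<omega> :: "nat \<Rightarrow> real^'n^'c"
  assumes "CARD('c) \<le> CARD('m)"
    and "twice_continuously_differentiable ell"
    and "twice_continuously_differentiable f"
    and "twice_continuously_differentiable c"
    and "xb 1 = xhat"
    and "\<And>t. t \<in> {1..<N} \<Longrightarrow> xb (t + 1) = f (xb t, ub t)"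
    and "backward_pass N ell f c xb ub \<phi>b V lam P \<delta>w \<delta>c \<alpha> \<beta> \<psi> \<omega>"
  shows "((\<lambda>\<gamma>. total_Lag N ell c (trial_point f xhat xb ub \<phi>b \<alpha> \<beta> \<psi> \<omega> \<gamma>))
            has_real_derivative
          (\<Sum>t=1..N. Q_u ell f c (xb t) (ub t) (\<phi>b t) (V (t + 1)) \<bullet> \<alpha> t + \<psi> t \<bullet> c (xb t, ub t)))
          (at 0)"
proof -
  let ?x = "\<lambda>\<gamma>. trial_x f xhat xb ub \<alpha> \<beta> \<gamma>"
  let ?L = "\<lambda>t \<gamma>. case trial_point f xhat xb ub \<phi>b \<alpha> \<beta> \<psi> \<omega> \<gamma> t of (x, u, \<phi>) \<Rightarrow> Lag ell c x u \<phi>"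
  let ?m = "\<lambda>t. Q_u ell f c (xb t) (ub t) (\<phi>b t) (V (t + 1)) \<bullet> \<alpha> t + \<psi> t \<bullet> c (xb t, ub t)"
  note diff = assms(2-4)[THEN twice_continuously_differentiable_imp_differentiable]
  have V_end: "V (N + 1) = 0"
    using assms(7) by (simp add: backward_pass_def)
  have V: "V t = Q_x ell f c (xb t) (ub t) (\<phi>b t) (V (t + 1))
                 + Q_u ell f c (xb t) (ub t) (\<phi>b t) (V (t + 1)) v* \<beta> t
                 + c (xb t, ub t) v* \<omega> t" if "t \<in> {1..N}" for t
    using assms(7) that unfolding backward_pass_def Let_def by auto
  \<comment> \<open>At step size 0 both corrections to the control vanish, so the trial states
    follow the iterate's own dynamics. The shift skips the dummy index 0.\<close>
  have "?x 0 (Suc k) = xb (Suc k)" if "k < N" for k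
    using that
  proof (induction k)
    case (Suc k)
    then show ?case using assms(6)[of "Suc k"] by (simp add: trial_u_def)
  qed (use assms(5) in simp)
  then have x0: "?x 0 t = xb t" if "t \<in> {1..N}" for t
    using that by (cases t) auto
  \<comment> \<open>Telescoping invariant: after \<open>k\<close> stages only the boundary term at
    \<open>k + 1\<close> remains. For \<open>k = N\<close> it involves a state beyond the horizon,
    which \<open>trial_x\<close> still defines.\<close>
  have "\<exists>d. ((\<lambda>\<gamma>. ?x \<gamma> (k + 1)) has_vector_derivative d) (at 0) \<and>
      ((\<lambda>\<gamma>. \<Sum>t=1..k. ?L t \<gamma>) has_real_derivative (\<Sum>t=1..k. ?m t) - V (k + 1) \<bullet> d) (at 0)"
    if "k \<le> N" for k
    using that
  proof (induction k)
    case 0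
    \<comment> \<open>The first trial state is \<open>xhat\<close> for every \<gamma>, hence the
      witness 0.\<close>
    then show ?case by (intro exI[of _ 0]) simp
  next
    case (Suc k)
    define t where "t = Suc k"
    have t: "t \<in> {1..N}" using Suc.prems by (simp add: t_def)
    obtain d where d: "((\<lambda>\<gamma>. ?x \<gamma> t) has_vector_derivative d) (at 0)"
      and IH: "((\<lambda>\<gamma>. \<Sum>t=1..k. ?L t \<gamma>) has_real_derivative (\<Sum>t=1..k. ?m t) - V t \<bullet> d) (at 0)"
      using Suc by (auto simp: t_def)
    \<comment> \<open>Generic in the dimension, to cover both controls and multipliers.\<close>
    have affine: "((\<lambda>\<gamma>. b + \<gamma> *\<^sub>R a + M *v (?x \<gamma> t - xb t)) has_vector_derivative a + M *v d) (at 0)"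
      for b a :: "real^'k" and M
    proof -
      have "((\<lambda>\<gamma>. M *v (?x \<gamma> t - xb t)) has_vector_derivative M *v d) (at 0)"
        using bounded_linear.has_vector_derivative[OF matrix_vector_mul_bounded_linear
            has_vector_derivative_diff[OF d has_vector_derivative_const]] by simp
      moreover have "((\<lambda>\<gamma>. b + \<gamma> *\<^sub>R a) has_vector_derivative a) (at 0)"
        by (auto intro!: derivative_eq_intros)
      ultimately show ?thesis by (auto intro: has_vector_derivative_add)
    qed
    let ?u = "\<lambda>\<gamma>. trial_u xb ub \<alpha> \<beta> t (?x \<gamma> t) \<gamma>"
    let ?\<phi> = "\<lambda>\<gamma>. trial_phi xb \<phi>b \<psi> \<omega> t (?x \<gamma> t) \<gamma>"
    define e where "e = \<alpha> t + \<beta> t *v d"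
    have u: "(?u has_vector_derivative e) (at 0)"
      and \<phi>: "(?\<phi> has_vector_derivative \<psi> t + \<omega> t *v d) (at 0)"
      unfolding trial_u_def trial_phi_def e_def by (rule affine)+
    have at0: "?x 0 t = xb t" "trial_u xb ub \<alpha> \<beta> t (xb t) 0 = ub t"
        "trial_phi xb \<phi>b \<psi> \<omega> t (xb t) 0 = \<phi>b t"
      using x0[OF t] by (simp_all add: trial_u_def trial_phi_def)
    define d' where "d' = jac_x f (xb t) (ub t) *v d + jac_u f (xb t) (ub t) *v e"
    have "((\<lambda>\<gamma>. f (?x \<gamma> t, ?u \<gamma>)) has_vector_derivative d') (at 0)"
      using has_vector_derivative_jacobian_chain[OF diff(2) d u] by (simp only: at0 d'_def)
    \<comment> \<open>Since \<open>t\<close> is a successor, \<open>trial_x\<close> unfolds to the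
      dynamics and not to \<open>xhat\<close>.\<close>
    then have x': "((\<lambda>\<gamma>. ?x \<gamma> (t + 1)) has_vector_derivative d') (at 0)"
      by (simp add: t_def)
    have "(?L t has_real_derivative
        Lag_x ell c (xb t) (ub t) (\<phi>b t) \<bullet> d + Lag_u ell c (xb t) (ub t) (\<phi>b t) \<bullet> e
        + c (xb t, ub t) \<bullet> (\<psi> t + \<omega> t *v d)) (at 0)"
      using has_real_derivative_Lag[OF diff(1,3) d u \<phi>]
      by (simp only: at0 trial_point_def Let_def prod.case)
    \<comment> \<open>The \<open>V (t + 1)\<close> terms inside \<open>Q_x\<close> and
      \<open>Q_u\<close> cancel against \<open>V (t + 1) \<bullet> d'\<close>;
      \<open>dot_lmul_matrix\<close> moves the matrices onto \<open>d\<close> and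
      \<open>e\<close>.\<close>
    also have "Lag_x ell c (xb t) (ub t) (\<phi>b t) \<bullet> d + Lag_u ell c (xb t) (ub t) (\<phi>b t) \<bullet> e
        + c (xb t, ub t) \<bullet> (\<psi> t + \<omega> t *v d) = ?m t + V t \<bullet> d - V (t + 1) \<bullet> d'"
      unfolding V[OF t] d'_def e_def Q_x_def Q_u_def
      by (simp add: inner_add_left inner_add_right dot_lmul_matrix
          matrix_vector_right_distrib inner_commute[of "\<psi> t" "c (xb t, ub t)"])
    finally have "((\<lambda>\<gamma>. (\<Sum>t=1..k. ?L t \<gamma>) + ?L t \<gamma>) has_real_derivative
        ((\<Sum>t=1..k. ?m t) - V t \<bullet> d) + (?m t + V t \<bullet> d - V (t + 1) \<bullet> d')) (at 0)"
      by (rule DERIV_add[OF IH])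
    with x' show ?case
      by (intro exI[of _ d']) (simp add: t_def algebra_simps)
  qed
  from this[of N] show ?thesis
    using V_end by (auto simp: total_Lag_def)
qed

end
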